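(* Let $\delta\in(0,1/4)$ be fixed, and let $X$ and $L$ be as defined in the context. Suppose $(p_m,q_m)$, $m=1,2,\dots$, is a sequence of points in $\mathbb{R}^2$ and $\alpha\in\mathbb{R}$ are such that for all $m$ $$X(p_m,q_m)=0,\qquad |p_m|>x_M,\qquad q_m\neq 0,\qquad \left|\frac{q_m}{p_m}\right|<1-2\delta,$$ and $|p_m|\to\infty$, $\lim_{m\to\infty}\frac{q_m}{p_m}=\alpha$. Then $$\frac{d^L}{dz^L}\left(\frac{z^{L+1}}{(1+z^2)^{3/2}}\right)\bigg|_{z=\alpha}=0.$$
   Context: Let $M\ge1$, let $0<x_1<x_2<\cdots<x_M$ be real numbers and let $a_1,\dots,a_M$ be real numbers, not all zero. For $(x,y)\in\mathbb{R}^2\setminus\{(x_1,0),\dots,(x_M,0)\}$ let $$X(x,y)=\sum_{j=1}^M\frac{a_j(x-x_j)}{((x-x_j)^2+y^2)^{3/2}}.$$ Let $\mu_k=\sum_{j=1}^M a_jx_j^k$ for $k=0,1,\dots$. The integer $L$, $0\le L\le M-1$, is the unique integer such that $\mu_k=0$ for $k=0,1,\dots,L-1$ and $\mu_L\neq0$ (it exists by the non-vanishing of Vandermonde determinants). The $0$th derivative of a function is the function itself. *)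

theory Defs
  imports "HOL-Analysis.Analysis" "HOL-Computational_Algebra.Polynomial"
begin

text \<open>The points \<open>(x\<^sub>j, 0)\<close> and the weights \<open>a\<^sub>j\<close>, \<open>1 \<le> j \<le> M\<close>, are given by functions
  on \<open>nat\<close>, of which only the values on \<open>{1..M}\<close> matter.\<close>

text \<open>The function \<open>X\<close> is meant on the plane without the points \<open>(x\<^sub>j, 0)\<close>; at such a point
  the totalised division makes the \<open>j\<close>-th summand \<open>0\<close>.\<close>

definition field_X :: "nat \<Rightarrow> (nat \<Rightarrow> real) \<Rightarrow> (nat \<Rightarrow> real) \<Rightarrow> real \<Rightarrow> real \<Rightarrow> real" where
  "field_X M x a u v =
     (\<Sum>j=1..M. a j * (u - x j) / ((u - x j)\<^sup>2 + v\<^sup>2) powr (3/2))"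

definition moment :: "nat \<Rightarrow> (nat \<Rightarrow> real) \<Rightarrow> (nat \<Rightarrow> real) \<Rightarrow> nat \<Rightarrow> real" where
  "moment M x a k = (\<Sum>j=1..M. a j * x j ^ k)"

definition moment_index :: "nat \<Rightarrow> (nat \<Rightarrow> real) \<Rightarrow> (nat \<Rightarrow> real) \<Rightarrow> nat" where
  "moment_index M x a =
     (THE L. L \<le> M - 1 \<and> (\<forall>k<L. moment M x a k = 0) \<and> moment M x a L \<noteq> 0)"

lemma exists_moment_nonzero:
  fixes x a :: "nat \<Rightarrow> real"
  assumes inj: "inj_on x {1..M}" and nz: "\<exists>j\<in>{1..M}. a j \<noteq> 0"
  shows "\<exists>k\<le>M - 1. moment M x a k \<noteq> 0"
proof (rule ccontr)
  assume "\<not> ?thesis"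
  then have z: "moment M x a k = 0" if "k \<le> M - 1" for k
    using that by blast
  obtain j where j: "j \<in> {1..M}" "a j \<noteq> 0"
    using nz by blast
  define p where "p = (\<Prod>i\<in>{1..M} - {j}. [:- x i, 1:])"
  have "degree p = (\<Sum>i\<in>{1..M} - {j}. degree [:- x i, 1:])"
    unfolding p_def by (rule degree_prod_eq_sum_degree) simp
  also have "\<dots> = M - 1"
    using j by simp
  finally have deg: "degree p = M - 1" .
  have ev: "poly p t = (\<Prod>i\<in>{1..M} - {j}. t - x i)" for t
    unfolding p_def poly_prod by simp
  have other: "poly p (x l) = 0" if "l \<in> {1..M} - {j}" for l
    unfolding ev by (rule prod_zero) (use that in auto)
  have "poly p (x j) \<noteq> 0"
  proof -
    have "x j - x i \<noteq> 0" if "i \<in> {1..M} - {j}" for i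
      using inj_onD[OF inj, of j i] that j(1) by force
    then show ?thesis
      unfolding ev by (subst prod_zero_iff) (simp, blast)
  qed
  moreover have "(\<Sum>l=1..M. a l * poly p (x l)) = a j * poly p (x j)"
    using j(1) other by (subst sum.remove[of _ j]) auto
  moreover have "(\<Sum>l=1..M. a l * poly p (x l)) = (\<Sum>k\<le>M - 1. coeff p k * moment M x a k)"
    unfolding poly_altdef deg moment_def sum_distrib_left
    by (subst sum.swap) (simp add: algebra_simps)
  ultimately show False
    using z j(2) by simp
qed

lemma moment_index_properties:
  fixes x a :: "nat \<Rightarrow> real"
  assumes "strict_mono_on {1..M} x" and "\<exists>j\<in>{1..M}. a j \<noteq> 0"
  shows "moment_index M x a \<le> M - 1"
    and "\<And>k. k < moment_index M x a \<Longrightarrow> moment M x a k = 0"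
    and "moment M x a (moment_index M x a) \<noteq> 0"
proof -
  let ?P = "\<lambda>L. L \<le> M - 1 \<and> (\<forall>k<L. moment M x a k = 0) \<and> moment M x a L \<noteq> 0"
  have "inj_on x {1..M}"
    using assms(1) by (rule strict_mono_on_imp_inj_on)
  then obtain K where K: "K \<le> M - 1" "moment M x a K \<noteq> 0"
    using exists_moment_nonzero assms(2) by blast
  let ?L = "LEAST k. moment M x a k \<noteq> 0"
  have "moment M x a ?L \<noteq> 0"
    using K(2) by (rule LeastI)
  moreover have "?L \<le> M - 1"
    using Least_le[of "\<lambda>k. moment M x a k \<noteq> 0", OF K(2)] K(1) by simp
  moreover have "\<forall>k<?L. moment M x a k = 0"
    using not_less_Least by blast
  ultimately have "?P ?L"
    by blast
  moreover have "L = L'" if "?P L" "?P L'" for L L'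
    using that by (metis linorder_neqE_nat)
  ultimately have "\<exists>!L. ?P L"
    by (intro ex1I) assumption+
  then have "?P (moment_index M x a)"
    unfolding moment_index_def by (rule theI')
  then show "moment_index M x a \<le> M - 1"
    and "\<And>k. k < moment_index M x a \<Longrightarrow> moment M x a k = 0"
    and "moment M x a (moment_index M x a) \<noteq> 0"
    by blast+
qed

end

theory Submission
  imports Defs
begin

text \<open>
  Put \<open>\<phi> y = (1 + y\<^sup>2) powr (-3/2)\<close>. With \<open>z = q / p\<close> and \<open>r\<^sub>j = 1 - x\<^sub>j / p\<close>, which is positive
  because \<open>\<bar>p\<bar> > x\<^sub>M\<close>, the field is the nonzero factor \<open>p / \<bar>p\<bar>\<^sup>3\<close> times
  \<open>\<Sum>j. a\<^sub>j h\<^sub>z(r\<^sub>j)\<close>, where \<open>h\<^sub>z(r) = \<phi>(z / r) / r\<^sup>2\<close>. All \<open>r\<^sub>j\<close> tend to \<open>1\<close>, so \<open>h\<^sub>z\<close> is expanded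
  by Taylor's formula at \<open>1\<close>, with Lagrange remainder of order \<open>L\<close>. The \<open>k\<close>-th Taylor term
  contributes a multiple of the moment \<open>\<mu>\<^sub>k\<close>, which vanishes for \<open>k < L\<close>. Hence only the
  remainders are left: \<open>\<Sum>j. a\<^sub>j x\<^sub>j\<^sup>L h\<^sub>z\<^sup>(\<^sup>L\<^sup>)(\<xi>\<^sub>j) = 0\<close> with \<open>\<xi>\<^sub>j\<close> between \<open>1\<close> and \<open>r\<^sub>j\<close>. In the limit
  this reads \<open>\<mu>\<^sub>L h\<^sub>\<alpha>\<^sup>(\<^sup>L\<^sup>)(1) = 0\<close>, and \<open>\<mu>\<^sub>L \<noteq> 0\<close>.

  It remains to compare the derivatives of \<open>h\<^sub>\<alpha>\<close> at \<open>1\<close> with the derivative in the conclusion.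
  Let \<open>S\<^sub>0 = \<phi>\<close> and \<open>S\<^sub>k\<^sub>+\<^sub>1(y) = y S\<^sub>k'(y) + (k + 2) S\<^sub>k(y)\<close>. Since \<open>h\<^sub>z(r)\<close> is homogeneous of degree
  \<open>-2\<close> in \<open>(r, z)\<close>, Euler's relation turns differentiation in \<open>r\<close> into this recursion:
  \<open>h\<^sub>z\<^sup>(\<^sup>k\<^sup>)(r) = (-1)\<^sup>k S\<^sub>k(z / r) / r\<^sup>k\<^sup>+\<^sup>2\<close> (lemma \<open>radial_derivative_DERIV\<close>). On the other side,
  Leibniz' rule for a product with the identity gives \<open>d\<^sup>k/dy\<^sup>k (y\<^sup>k\<^sup>+\<^sup>1 \<phi>(y)) = y S\<^sub>k(y)\<close>
  (lemma \<open>funpow_deriv_power_times\<close>). So \<open>S\<^sub>L(\<alpha>) = 0\<close> implies the claim. Both identities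
  hold for every smooth \<open>\<phi>\<close>.
\<close>

section \<open>Smooth functions on the real line\<close>

text \<open>With the coinductive definition, a family of functions consists of smooth functions as soon
  as it is closed under differentiation. So the closure properties below need no formula for
  higher derivatives.\<close>

coinductive smooth :: "(real \<Rightarrow> real) \<Rightarrow> bool" where
  "(\<And>z. (f has_real_derivative f' z) (at z)) \<Longrightarrow> smooth f' \<Longrightarrow> smooth f"

lemma smooth_DERIV_deriv:
  assumes "smooth f"
  shows "(f has_real_derivative deriv f z) (at z)" and "smooth (deriv f)"
proof -
  obtain f' where f': "\<And>z. (f has_real_derivative f' z) (at z)" "smooth f'"
    using assms by (rule smooth.cases) blast
  have "deriv f = f'"
    using f'(1) by (intro ext DERIV_imp_deriv)
  then show "(f has_real_derivative deriv f z) (at z)" and "smooth (deriv f)"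
    using f' by simp_all
qed

lemma smooth_funpow_deriv: "smooth f \<Longrightarrow> smooth ((deriv ^^ n) f)"
  by (induction n) (auto intro: smooth_DERIV_deriv)

lemma smooth_if_closed_under_derivative:
  assumes "f \<in> F"
    and closed: "\<And>h. h \<in> F \<Longrightarrow> \<exists>h'\<in>F. \<forall>z. (h has_real_derivative h' z) (at z)"
  shows "smooth f"
  using assms(1)
proof (rule smooth.coinduct[of "\<lambda>h. h \<in> F"])
  fix h assume "h \<in> F"
  then obtain h' where "h' \<in> F" "\<forall>z. (h has_real_derivative h' z) (at z)"
    using closed[OF \<open>h \<in> F\<close>] by (elim bexE)
  then show "\<exists>f f'. h = f \<and> (\<forall>z. (f has_real_derivative f' z) (at z)) \<and> (f' \<in> F \<or> smooth f')"
    by (intro exI[of _ h] exI[of _ h']) simp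
qed

lemma smooth_add:
  assumes "smooth f" and "smooth g"
  shows "smooth (\<lambda>z. f z + g z)"
proof (rule smooth_if_closed_under_derivative[of _ "{\<lambda>z. f z + g z | f g. smooth f \<and> smooth g}"])
  fix h assume "h \<in> {\<lambda>z. f z + g z | f g. smooth f \<and> smooth g}"
  then obtain f g where h: "h = (\<lambda>z. f z + g z)" "smooth f" "smooth g"
    by blast
  show "\<exists>h'\<in>{\<lambda>z. f z + g z | f g. smooth f \<and> smooth g}. \<forall>z. (h has_real_derivative h' z) (at z)"
  proof (intro bexI[of _ "\<lambda>z. deriv f z + deriv g z"] allI)
    show "(h has_real_derivative deriv f z + deriv g z) (at z)" for z
      unfolding h(1) by (intro DERIV_add smooth_DERIV_deriv h)
  qed (use h smooth_DERIV_deriv(2) in blast)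
qed (use assms in blast)

lemma smooth_cmult:
  assumes "smooth f"
  shows "smooth (\<lambda>z. c * f z)"
proof (rule smooth_if_closed_under_derivative[of _ "{\<lambda>z. c * f z | f. smooth f}"])
  fix h assume "h \<in> {\<lambda>z. c * f z | f. smooth f}"
  then obtain f where h: "h = (\<lambda>z. c * f z)" "smooth f"
    by blast
  show "\<exists>h'\<in>{\<lambda>z. c * f z | f. smooth f}. \<forall>z. (h has_real_derivative h' z) (at z)"
  proof (intro bexI[of _ "\<lambda>z. c * deriv f z"] allI)
    show "(h has_real_derivative c * deriv f z) (at z)" for z
      unfolding h(1) by (intro DERIV_cmult smooth_DERIV_deriv h)
  qed (use h smooth_DERIV_deriv(2) in blast)
qed (use assms in blast)

text \<open>The functions \<open>z f(z)\<close> alone are not closed under differentiation, because the derivative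
  is \<open>z f'(z) + f(z)\<close>. The functions \<open>z f(z) + g(z)\<close> are.\<close>

lemma smooth_id_times:
  assumes "smooth f"
  shows "smooth (\<lambda>z. z * f z)"
proof (rule smooth_if_closed_under_derivative
    [of _ "{\<lambda>z. z * f z + g z | f g. smooth f \<and> smooth g}"])
  fix h assume "h \<in> {\<lambda>z. z * f z + g z | f g. smooth f \<and> smooth g}"
  then obtain f g where h: "h = (\<lambda>z. z * f z + g z)" "smooth f" "smooth g"
    by blast
  show "\<exists>h'\<in>{\<lambda>z. z * f z + g z | f g. smooth f \<and> smooth g}.
      \<forall>z. (h has_real_derivative h' z) (at z)"
  proof (intro bexI[of _ "\<lambda>z. z * deriv f z + (f z + deriv g z)"] allI)
    show "(h has_real_derivative z * deriv f z + (f z + deriv g z)) (at z)" for z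
      unfolding h(1) by (auto intro!: derivative_eq_intros smooth_DERIV_deriv h(2,3))
    have "smooth (\<lambda>z. f z + deriv g z)"
      using h smooth_DERIV_deriv(2) smooth_add by blast
    then show "(\<lambda>z. z * deriv f z + (f z + deriv g z)) \<in>
        {\<lambda>z. z * f z + g z | f g. smooth f \<and> smooth g}"
      using smooth_DERIV_deriv(2)[OF h(2)]
      by (intro CollectI exI[of _ "deriv f"] exI[of _ "\<lambda>z. f z + deriv g z"]) simp
  qed
next
  have "smooth (\<lambda>z. 0)"
    using smooth_cmult[OF assms, of 0] by simp
  then show "(\<lambda>z. z * f z) \<in> {\<lambda>z. z * f z + g z | f g. smooth f \<and> smooth g}"
    using assms by (intro CollectI exI[of _ f] exI[of _ "\<lambda>z. 0"]) simp
qed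

lemma smooth_power_times: "smooth f \<Longrightarrow> smooth (\<lambda>z. z ^ n * f z)"
proof (induction n)
  case (Suc n)
  then show ?case
    using smooth_id_times[of "\<lambda>z. z ^ n * f z"] by (simp add: mult.assoc)
qed simp

lemma smooth_poly_times_powr: "smooth (\<lambda>y. poly P y * (1 + y\<^sup>2) powr c)"
proof (rule smooth_if_closed_under_derivative
    [of _ "{\<lambda>y::real. poly P y * (1 + y\<^sup>2) powr c | P c. True}"])
  fix h :: "real \<Rightarrow> real"
  assume "h \<in> {\<lambda>y. poly P y * (1 + y\<^sup>2) powr c | P c. True}"
  then obtain P c where h: "h = (\<lambda>y. poly P y * (1 + y\<^sup>2) powr c)"
    by blast
  let ?Q = "pderiv P * [:1, 0, 1:] + [:0, 2 * c:] * P"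
  show "\<exists>h'\<in>{\<lambda>y. poly P y * (1 + y\<^sup>2) powr c | P c. True}.
      \<forall>y. (h has_real_derivative h' y) (at y)"
  proof (intro bexI[of _ "\<lambda>y. poly ?Q y * (1 + y\<^sup>2) powr (c - 1)"] allI)
    fix y :: real
    have pos: "1 + y\<^sup>2 > 0"
      by (simp add: add_pos_nonneg)
    have "(1 + y\<^sup>2) powr c = (1 + y\<^sup>2) * (1 + y\<^sup>2) powr (c - 1)"
      using pos by (simp add: powr_diff)
    then show "(h has_real_derivative poly ?Q y * (1 + y\<^sup>2) powr (c - 1)) (at y)"
      unfolding h using pos
      by (auto intro!: derivative_eq_intros simp: algebra_simps power2_eq_square)
  qed blast
qed blast

lemma funpow_deriv_id_times:
  assumes "smooth f"
  shows "(deriv ^^ Suc n) (\<lambda>y. y * f y) =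
    (\<lambda>y. y * (deriv ^^ Suc n) f y + real (Suc n) * (deriv ^^ n) f y)"
proof -
  have D: "((deriv ^^ k) f has_real_derivative (deriv ^^ Suc k) f y) (at y)" for k y
    using smooth_DERIV_deriv(1)[OF smooth_funpow_deriv[OF assms]] by simp
  show ?thesis
  proof (induction n)
    case 0
    show ?case
      using D[of 0] by (auto intro!: ext DERIV_imp_deriv derivative_eq_intros)
  next
    case (Suc n)
    have "(deriv ^^ Suc (Suc n)) (\<lambda>y. y * f y) =
        deriv (\<lambda>y. y * (deriv ^^ Suc n) f y + real (Suc n) * (deriv ^^ n) f y)"
      using Suc by simp
    also have "\<dots> = (\<lambda>y. y * (deriv ^^ Suc (Suc n)) f y + real (Suc (Suc n)) * (deriv ^^ Suc n) f y)"
      by (intro ext DERIV_imp_deriv derivative_eq_intros D)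
        (rule refl D | simp add: algebra_simps del: funpow.simps)+
    finally show ?case .
  qed
qed

section \<open>Radial derivatives of a homogeneous function of degree -2\<close>

text \<open>Up to the sign \<open>(-1)\<^sup>k\<close>, \<open>radial_derivative \<phi> k z\<close> is the \<open>k\<close>-th derivative of
  \<open>r \<mapsto> \<phi> (z / r) / r\<^sup>2\<close> at \<open>r = 1\<close>.\<close>

primrec radial_derivative :: "(real \<Rightarrow> real) \<Rightarrow> nat \<Rightarrow> real \<Rightarrow> real" where
  "radial_derivative \<phi> 0 = \<phi>"
| "radial_derivative \<phi> (Suc k) =
     (\<lambda>y. y * deriv (radial_derivative \<phi> k) y + (real k + 2) * radial_derivative \<phi> k y)"

lemma smooth_radial_derivative: "smooth \<phi> \<Longrightarrow> smooth (radial_derivative \<phi> k)"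
  by (induction k) (auto intro!: smooth_add smooth_id_times smooth_cmult smooth_DERIV_deriv(2))

text \<open>The exponent \<open>k + 1\<close> grows together with the order of differentiation; thus each step
  multiplies by one further factor \<open>y\<close>, and Leibniz' rule has only two terms. These form
  the recursion of \<open>radial_derivative\<close>.\<close>

lemma funpow_deriv_power_times:
  assumes "smooth \<phi>"
  shows "(deriv ^^ k) (\<lambda>y. y ^ (k + 1) * \<phi> y) = (\<lambda>y. y * radial_derivative \<phi> k y)"
proof (induction k)
  case (Suc k)
  let ?S = "radial_derivative \<phi> k"
  have S': "deriv (\<lambda>y. y * ?S y) = (\<lambda>y. y * deriv ?S y + ?S y)"
    by (auto intro!: ext DERIV_imp_deriv derivative_eq_intros smooth_DERIV_deriv(1)
        smooth_radial_derivative assms)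
  have "(deriv ^^ Suc k) (\<lambda>y. y ^ (Suc k + 1) * \<phi> y) =
      (deriv ^^ Suc k) (\<lambda>y. y * (y ^ (k + 1) * \<phi> y))"
    by (simp add: mult.assoc)
  also have "\<dots> = (\<lambda>y. y * (y * deriv ?S y + ?S y) + real (Suc k) * (y * ?S y))"
    unfolding funpow_deriv_id_times[OF smooth_power_times[OF assms]]
    by (simp add: Suc S' del: power_Suc add_Suc_right One_nat_def)
  also have "\<dots> = (\<lambda>y. y * radial_derivative \<phi> (Suc k) y)"
    by (simp add: fun_eq_iff algebra_simps)
  finally show ?case .
qed simp

text \<open>As a function of both variables, the \<open>k\<close>-th \<open>r\<close>-derivative is homogeneous of degree \<open>-(k + 2)\<close> in \<open>(r, z)\<close>, so
  that it is determined by its values at \<open>r = 1\<close>. By Euler's relation, the next \<open>r\<close>-derivative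
  at \<open>r = 1\<close> is \<open>-(k + 2)\<close> times the function minus \<open>z\<close> times its \<open>z\<close>-derivative.\<close>

lemma radial_derivative_DERIV:
  assumes "smooth \<phi>" and "r > 0"
  shows "((\<lambda>r. (-1) ^ k * radial_derivative \<phi> k (z / r) / r ^ (k + 2)) has_real_derivative
     (-1) ^ Suc k * radial_derivative \<phi> (Suc k) (z / r) / r ^ (Suc k + 2)) (at r)"
proof -
  let ?S = "radial_derivative \<phi> k"
  have inner: "((\<lambda>r. z / r) has_real_derivative - z / r\<^sup>2) (at r)"
    using assms(2) by (auto intro!: derivative_eq_intros simp: power2_eq_square)
  have D: "((\<lambda>r. ?S (z / r)) has_real_derivative deriv ?S (z / r) * (- z / r\<^sup>2)) (at r)"
    using DERIV_chain[OF smooth_DERIV_deriv(1)[OF smooth_radial_derivative[OF assms(1)]] inner]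
    by (simp add: o_def)
  have "((\<lambda>r. r ^ (k + 2)) has_real_derivative (real k + 2) * r ^ (k + 1)) (at r)"
    using DERIV_pow[of "k + 2" r] by (simp add: add.commute)
  from DERIV_divide[OF DERIV_cmult[OF D, of "(-1) ^ k"] this]
  have quotient: "((\<lambda>r. (-1) ^ k * ?S (z / r) / r ^ (k + 2)) has_real_derivative
      ((-1) ^ k * (deriv ?S (z / r) * (- z / r\<^sup>2)) * r ^ (k + 2)
        - (-1) ^ k * ?S (z / r) * ((real k + 2) * r ^ (k + 1))) / (r ^ (k + 2) * r ^ (k + 2))) (at r)"
    using assms(2) by simp
  have "(e * (s' * (- z / r\<^sup>2)) * (w * r\<^sup>2) - e * s * (c * (w * r))) / (w * r\<^sup>2 * (w * r\<^sup>2)) =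
      - e * (z / r * s' + c * s) / (w * r ^ 3)" if "w > 0" for e s s' c w
    using that assms(2) by (simp add: divide_simps) (simp add: algebra_simps power2_eq_square power3_eq_cube)
  from this[of "r ^ k" "(-1) ^ k" "deriv ?S (z / r)" "?S (z / r)" "real k + 2"]
  show ?thesis
    using quotient assms(2) by (simp add: power_add power2_eq_square power3_eq_cube mult_ac)
qed

lemma radial_Taylor:
  assumes "smooth \<phi>" and "r > 0"
  shows "\<exists>\<xi>\<in>{min r 1..max r 1}. \<phi> (z / r) / r\<^sup>2 =
      (\<Sum>k<n. (-1) ^ k * radial_derivative \<phi> k z / fact k * (r - 1) ^ k)
      + (-1) ^ n * radial_derivative \<phi> n (z / \<xi>) / \<xi> ^ (n + 2) / fact n * (r - 1) ^ n"
  \<comment> \<open>Taylor's theorem needs positive order and a point different from the center; the other cases are immediate.\<close>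
proof (cases "n = 0 \<or> r = 1")
  case True
  then show ?thesis
  proof
    assume "n = 0"
    then show ?thesis
      by (intro bexI[of _ r]) (auto simp: power2_eq_square)
  next
    assume "r = 1"
    then show ?thesis
      by (cases n) (auto simp: lessThan_Suc_eq_insert_0 sum.insert_if power_0_left sum.reindex)
  qed
next
  case False
  let ?d = "\<lambda>k r. (-1) ^ k * radial_derivative \<phi> k (z / r) / r ^ (k + 2)"
  have "\<exists>t. (if r < 1 then r < t \<and> t < 1 else 1 < t \<and> t < r) \<and>
      ?d 0 r = (\<Sum>k<n. ?d k 1 / fact k * (r - 1) ^ k) + ?d n t / fact n * (r - 1) ^ n"
  proof (rule Taylor[of n ?d "?d 0" "min r 1" "max r 1"])
    show "\<forall>k t. k < n \<and> min r 1 \<le> t \<and> t \<le> max r 1 \<longrightarrow> (?d k has_real_derivative ?d (Suc k) t) (at t)"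
      using assms(2) by (intro allI impI radial_derivative_DERIV assms(1)) (auto simp: min_def split: if_splits)
  qed (use False in auto)
  then obtain t where "if r < 1 then r < t \<and> t < 1 else 1 < t \<and> t < r"
      and "?d 0 r = (\<Sum>k<n. ?d k 1 / fact k * (r - 1) ^ k) + ?d n t / fact n * (r - 1) ^ n"
    by blast
  then show ?thesis
    by (intro bexI[of _ t]) (auto simp: min_def max_def power2_eq_square split: if_splits)
qed

section \<open>Zeros of the field far away\<close>

text \<open>The \<open>k\<close>-th Taylor term at \<open>r\<^sub>j = 1 - x\<^sub>j / P\<close> is a factor independent of \<open>j\<close> times \<open>x\<^sub>j\<^sup>k\<close>, so
  the weighted sum over \<open>j\<close> turns it into a multiple of the \<open>k\<close>-th moment. The remainders have the
  common factor \<open>(-1 / P)\<^sup>L\<close>. It is divided out, and what is left has a limit as \<open>\<bar>P\<bar>\<close>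
  tends to infinity, simply by continuity, because the bound on \<open>\<xi>\<^sub>j\<close> forces \<open>\<xi>\<^sub>j\<close> to tend to \<open>1\<close>.\<close>

lemma moments_eliminate_Taylor_terms:
  fixes x a r :: "nat \<Rightarrow> real" and P z :: real
  defines "r \<equiv> \<lambda>j. 1 - x j / P"
  assumes "smooth \<phi>" and "P \<noteq> 0" and pos: "\<And>j. j \<in> {1..M} \<Longrightarrow> r j > 0"
    and mom: "\<And>k. k < L \<Longrightarrow> moment M x a k = 0"
    and zero: "(\<Sum>j=1..M. a j * (\<phi> (z / r j) / (r j)\<^sup>2)) = 0"
  shows "\<exists>\<xi>. (\<forall>j\<in>{1..M}. \<bar>\<xi> j - 1\<bar> \<le> \<bar>x j / P\<bar>) \<and>
     (\<Sum>j=1..M. a j * x j ^ L * (radial_derivative \<phi> L (z / \<xi> j) / \<xi> j ^ (L + 2))) = 0"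
proof -
  let ?S = "radial_derivative \<phi>"
  define c where "c = (\<lambda>k. (-1) ^ k * ?S k z / fact k * (- 1 / P) ^ k)"
  have pw: "(r j - 1) ^ k = (- 1 / P) ^ k * x j ^ k" for j k
    unfolding r_def by (simp flip: power_mult_distrib)
  have "\<forall>j\<in>{1..M}. \<exists>\<xi>. \<xi> \<in> {min (r j) 1..max (r j) 1} \<and> \<phi> (z / r j) / (r j)\<^sup>2 =
      (\<Sum>k<L. c k * x j ^ k)
      + (-1) ^ L * ?S L (z / \<xi>) / \<xi> ^ (L + 2) / fact L * ((- 1 / P) ^ L * x j ^ L)"
  proof
    fix j assume "j \<in> {1..M}"
    then show "\<exists>\<xi>. \<xi> \<in> {min (r j) 1..max (r j) 1} \<and> \<phi> (z / r j) / (r j)\<^sup>2 =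
      (\<Sum>k<L. c k * x j ^ k)
      + (-1) ^ L * ?S L (z / \<xi>) / \<xi> ^ (L + 2) / fact L * ((- 1 / P) ^ L * x j ^ L)"
      using radial_Taylor[OF assms(2) pos, of j z L] unfolding pw c_def by (auto simp: mult.assoc)
  qed
  from bchoice[OF this] obtain \<xi> where
    \<xi>: "\<And>j. j \<in> {1..M} \<Longrightarrow> \<xi> j \<in> {min (r j) 1..max (r j) 1}" and
    T: "\<And>j. j \<in> {1..M} \<Longrightarrow> \<phi> (z / r j) / (r j)\<^sup>2 =
      (\<Sum>k<L. c k * x j ^ k)
      + (-1) ^ L * ?S L (z / \<xi> j) / \<xi> j ^ (L + 2) / fact L * ((- 1 / P) ^ L * x j ^ L)"
    by blast
  let ?R = "\<Sum>j=1..M. a j * x j ^ L * (?S L (z / \<xi> j) / \<xi> j ^ (L + 2))"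
  let ?C = "(-1) ^ L / fact L * (- 1 / P) ^ L"
  have "0 = (\<Sum>j=1..M. (\<Sum>k<L. c k * (a j * x j ^ k))
      + ?C * (a j * x j ^ L * (?S L (z / \<xi> j) / \<xi> j ^ (L + 2))))"
    unfolding zero[symmetric]
    by (intro sum.cong refl) (simp add: T distrib_left sum_distrib_left mult_ac)
  also have "\<dots> = (\<Sum>k<L. c k * moment M x a k) + ?C * ?R"
    unfolding sum.distrib moment_def sum_distrib_left by (subst sum.swap) simp
  also have "\<dots> = ?C * ?R"
    using mom by simp
  finally have "?R = 0"
    using assms(3) by simp
  moreover have "\<bar>\<xi> j - 1\<bar> \<le> \<bar>x j / P\<bar>" if "j \<in> {1..M}" for j
    using \<xi>[OF that] unfolding r_def by (auto simp: min_def max_def abs_if split: if_splits)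
  ultimately show ?thesis
    by blast
qed

text \<open>By homogeneity the factor \<open>P\<close> can be taken out of each summand. Positivity of
  \<open>1 - x\<^sub>j / P\<close> ensures that the sign of \<open>P - x\<^sub>j\<close> is that of \<open>P\<close>, so the factor
  \<open>P / \<bar>P\<bar>\<^sup>3\<close> is the same for all \<open>j\<close>.\<close>

lemma field_X_scaled:
  fixes x :: "nat \<Rightarrow> real"
  assumes "P \<noteq> 0" and pos: "\<And>j. j \<in> {1..M} \<Longrightarrow> 1 - x j / P > 0"
  shows "field_X M x a P Q = P / \<bar>P\<bar> ^ 3 *
    (\<Sum>j=1..M. a j * ((1 + (Q / P / (1 - x j / P))\<^sup>2) powr (-3/2) / (1 - x j / P)\<^sup>2))"
proof -
  have "(P - x j) / ((P - x j)\<^sup>2 + Q\<^sup>2) powr (3/2) =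
      P / \<bar>P\<bar> ^ 3 * ((1 + (Q / P / (1 - x j / P))\<^sup>2) powr (-3/2) / (1 - x j / P)\<^sup>2)"
    if "j \<in> {1..M}" for j
  proof -
    define r where "r = 1 - x j / P"
    have r: "r > 0" "P - x j = P * r"
      using pos[OF that] assms(1) by (simp_all add: r_def field_simps)
    have "((P * r)\<^sup>2) powr (3/2) = (\<bar>P\<bar> * r) ^ 3"
    proof -
      have "((P * r)\<^sup>2) powr (3/2) = ((\<bar>P\<bar> * r) powr 2) powr (3/2)"
        using r assms(1) by (simp add: power_mult_distrib)
      also have "\<dots> = (\<bar>P\<bar> * r) ^ 3"
        unfolding powr_powr using r assms(1) by simp
      finally show ?thesis .
    qed
    moreover have "(P * r)\<^sup>2 + Q\<^sup>2 = (P * r)\<^sup>2 * (1 + (Q / P / r)\<^sup>2)"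
      using r assms(1) by (simp add: field_simps)
    ultimately have "((P * r)\<^sup>2 + Q\<^sup>2) powr (3/2) =
        (\<bar>P\<bar> * r) ^ 3 * (1 + (Q / P / r)\<^sup>2) powr (3/2)"
      by (simp add: powr_mult)
    moreover have "P * r / ((A * r) ^ 3 * w) = P / A ^ 3 * (1 / w / r\<^sup>2)" if "A > 0" for A w :: real
      using that r(1) by (cases "w = 0") (simp_all add: field_simps power2_eq_square power3_eq_cube)
    ultimately have "(P * r) / ((P * r)\<^sup>2 + Q\<^sup>2) powr (3/2) =
        P / \<bar>P\<bar> ^ 3 * ((1 + (Q / P / r)\<^sup>2) powr (-3/2) / r\<^sup>2)"
      using assms(1) by (simp add: powr_minus_divide)
    then show ?thesis
      using r(2) unfolding r_def by simp
  qed
  then show ?thesis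
    unfolding field_X_def sum_distrib_left by (intro sum.cong refl) (simp flip: times_divide_eq_right)
qed

theorem proposition2p8:
  fixes M L :: nat and x a :: "nat \<Rightarrow> real"
    and \<delta> \<alpha> :: real and p q :: "nat \<Rightarrow> real"
  assumes "M \<ge> 1"
    and "0 < x 1"
    and "strict_mono_on {1..M} x"
    and "\<exists>j\<in>{1..M}. a j \<noteq> 0"
    and "L = moment_index M x a"
    and "0 < \<delta>" and "\<delta> < 1/4"
    and "\<And>m. m \<ge> 1 \<Longrightarrow> field_X M x a (p m) (q m) = 0"
    and "\<And>m. m \<ge> 1 \<Longrightarrow> \<bar>p m\<bar> > x M"
    and "\<And>m. m \<ge> 1 \<Longrightarrow> q m \<noteq> 0"
    and "\<And>m. m \<ge> 1 \<Longrightarrow> \<bar>q m / p m\<bar> < 1 - 2 * \<delta>"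
    and "filterlim (\<lambda>m. \<bar>p m\<bar>) at_top sequentially"
    and "(\<lambda>m. q m / p m) \<longlonglongrightarrow> \<alpha>"
  shows "(deriv ^^ L) (\<lambda>z::real. z ^ (L + 1) / (1 + z\<^sup>2) powr (3/2)) \<alpha> = 0"
proof -
  define \<phi> where "\<phi> = (\<lambda>y::real. (1 + y\<^sup>2) powr (-3/2))"
  have "smooth \<phi>"
    using smooth_poly_times_powr[of 1 "-3/2"] by (simp add: \<phi>_def)
  let ?S = "radial_derivative \<phi> L"
  have remainders: "\<exists>\<xi>. (\<forall>j\<in>{1..M}. \<bar>\<xi> j - 1\<bar> \<le> \<bar>x j / p m\<bar>) \<and>
      (\<Sum>j=1..M. a j * x j ^ L * (?S (q m / p m / \<xi> j) / \<xi> j ^ (L + 2))) = 0" if "m \<ge> 1" for m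
  proof (rule moments_eliminate_Taylor_terms[OF \<open>smooth \<phi>\<close>])
    have bounds: "0 < x j" "x j \<le> x M" if "j \<in> {1..M}" for j
      using that assms(1,2) strict_mono_on_leD[OF assms(3), of 1 j]
        strict_mono_on_leD[OF assms(3), of j M] by auto
    show "p m \<noteq> 0"
      using assms(1) assms(9)[OF that] bounds[of M] by auto
    show pos: "1 - x j / p m > 0" if "j \<in> {1..M}" for j
    proof -
      have "\<bar>x j / p m\<bar> < 1"
        using bounds[OF that] assms(9)[OF \<open>m \<ge> 1\<close>] by (simp add: abs_divide)
      then show ?thesis
        by linarith
    qed
    show "moment M x a k = 0" if "k < L" for k
      using moment_index_properties(2)[OF assms(3,4)] that assms(5) by simp
    show "(\<Sum>j=1..M. a j * (\<phi> (q m / p m / (1 - x j / p m)) / (1 - x j / p m)\<^sup>2)) = 0"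
      using assms(8)[OF that] field_X_scaled[OF \<open>p m \<noteq> 0\<close> pos] \<open>p m \<noteq> 0\<close> by (simp add: \<phi>_def)
  qed
  have "\<forall>m\<in>{1..}. \<exists>\<xi>. (\<forall>j\<in>{1..M}. \<bar>\<xi> j - 1\<bar> \<le> \<bar>x j / p m\<bar>) \<and>
      (\<Sum>j=1..M. a j * x j ^ L * (?S (q m / p m / \<xi> j) / \<xi> j ^ (L + 2))) = 0"
    by (intro ballI remainders) simp
  from bchoice[OF this] obtain \<xi> where
    \<xi>: "\<And>m j. m \<in> {1..} \<Longrightarrow> j \<in> {1..M} \<Longrightarrow> \<bar>\<xi> m j - 1\<bar> \<le> \<bar>x j / p m\<bar>" and
    zero: "\<And>m. m \<in> {1..} \<Longrightarrow>
      (\<Sum>j=1..M. a j * x j ^ L * (?S (q m / p m / \<xi> m j) / \<xi> m j ^ (L + 2))) = 0"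
    by blast
  have lim: "(\<lambda>m. \<xi> m j) \<longlonglongrightarrow> 1" if "j \<in> {1..M}" for j
  proof -
    have "(\<lambda>m. \<bar>x j\<bar> / \<bar>p m\<bar>) \<longlonglongrightarrow> 0"
      by (rule real_tendsto_divide_at_top[OF tendsto_const assms(12)])
    moreover have "\<forall>\<^sub>F m in sequentially. norm (\<xi> m j - 1) \<le> \<bar>x j\<bar> / \<bar>p m\<bar>"
      using \<xi>[OF _ that] by (intro eventually_sequentiallyI[of 1]) (simp add: abs_divide)
    ultimately have "(\<lambda>m. \<xi> m j - 1) \<longlonglongrightarrow> 0"
      by (rule Lim_null_comparison[rotated])
    then show ?thesis
      by (simp add: LIM_zero_iff)
  qed
  have cont: "isCont ?S \<alpha>"
    by (rule DERIV_isCont[OF smooth_DERIV_deriv(1)[OF smooth_radial_derivative[OF \<open>smooth \<phi>\<close>]]])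
  have "(\<lambda>m. \<Sum>j=1..M. a j * x j ^ L * (?S (q m / p m / \<xi> m j) / \<xi> m j ^ (L + 2)))
      \<longlonglongrightarrow> (\<Sum>j=1..M. a j * x j ^ L * (?S \<alpha> / 1 ^ (L + 2)))"
  proof (intro tendsto_intros lim)
    fix j assume j: "j \<in> {1..M}"
    have "(\<lambda>m. q m / p m / \<xi> m j) \<longlonglongrightarrow> \<alpha> / 1"
      by (intro tendsto_intros assms(13) lim[OF j]) simp
    then show "(\<lambda>m. ?S (q m / p m / \<xi> m j)) \<longlonglongrightarrow> ?S \<alpha>"
      using isCont_tendsto_compose[OF cont] by simp
  qed auto
  moreover have "(\<lambda>m. \<Sum>j=1..M. a j * x j ^ L * (?S (q m / p m / \<xi> m j) / \<xi> m j ^ (L + 2))) \<longlonglongrightarrow> 0"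
    by (intro tendsto_eventually eventually_sequentiallyI[of 1] zero) simp
  ultimately have "(\<Sum>j=1..M. a j * x j ^ L * (?S \<alpha> / 1 ^ (L + 2))) = 0"
    by (rule LIMSEQ_unique)
  then have "moment M x a L * ?S \<alpha> = 0"
    by (simp add: moment_def sum_distrib_right)
  then have "?S \<alpha> = 0"
    using moment_index_properties(3)[OF assms(3,4)] assms(5) by simp
  moreover have "(\<lambda>z::real. z ^ (L + 1) / (1 + z\<^sup>2) powr (3/2)) = (\<lambda>z. z ^ (L + 1) * \<phi> z)"
    by (simp add: \<phi>_def powr_minus_divide)
  ultimately show ?thesis
    using funpow_deriv_power_times[OF \<open>smooth \<phi>\<close>, of L] by simp
qed

end
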